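(* Let $\boldsymbol{f}$ be a predictor on $\mathbb{R}^d$, $\rho$ a distance metric on $\mathbb{R}^d$, $\mathcal{D}_{\boldsymbol{x}}\subset\mathbb{R}^d$ a finite set of data inputs, $\boldsymbol{x}_{\text{test}}\in\mathbb{R}^d$ a point, and let $\mathcal{N}_k(\boldsymbol{x}_{\text{test}})\subset\mathcal{D}_{\boldsymbol{x}}$ be a set of $k$ nearest neighbors of $\boldsymbol{x}_{\text{test}}$ under $\rho$, with $\rho(\boldsymbol{x}_{\text{test}},\boldsymbol{z})>0$ for every $\boldsymbol{z}\in\mathcal{N}_k(\boldsymbol{x}_{\text{test}})$. Define the vector $\boldsymbol{g}_{\text{AVA}}(\boldsymbol{f},\boldsymbol{x}_{\text{test}})\in\mathbb{R}^d$ by $$\boldsymbol{g}_{\text{AVA}}(\boldsymbol{f},\boldsymbol{x}_{\text{test}})_i=\sum_{\boldsymbol{z}\in\mathcal{N}_k(\boldsymbol{x}_{\text{test}})}\frac{\phi_i(v_{\boldsymbol{z}})}{\rho(\boldsymbol{x}_{\text{test}},\boldsymbol{z})},\qquad i=1,\dots,d,$$ where $\phi_i(v_{\boldsymbol{z}})$ is the Shapley value of feature $i$ for the characteristic function $v_{\boldsymbol{z}}$ associated with $\boldsymbol{f}$ and $\boldsymbol{z}$. Then $\boldsymbol{g}_{\text{AVA}}(\boldsymbol{f},\boldsymbol{x}_{\text{test}})$ is a Shapley value explanation: it is the vector of Shapley values of the $d$-player game with characteristic function $v_{\text{AVA}}(S)=\sum_{\boldsymbol{z}\in\mathcal{N}_k(\boldsymbol{x}_{\text{test}})}\frac{v_{\boldsymbol{z}}(S)}{\rho(\boldsymbol{x}_{\text{test}},\boldsymbol{z})}$,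 $S\subseteq\{1,\dots,d\}$, that is, $$\boldsymbol{g}_{\text{AVA}}(\boldsymbol{f},\boldsymbol{x}_{\text{test}})_i=\phi_i(v_{\text{AVA}})\quad\text{for all } i\in\{1,\dots,d\}.$$
   Context: The players are the $d$ features, indexed by $\{1,\dots,d\}$. For a characteristic function $v:2^{\{1,\dots,d\}}\to\mathbb{R}$, the Shapley value of player $i$ is $$\phi_i(v)=\frac{1}{d}\sum_{S\subseteq\{1,\dots,d\}\setminus\{i\}}\binom{d-1}{|S|}^{-1}\bigl(v(S\cup\{i\})-v(S)\bigr),$$ and the vector of Shapley values of $v$ is $(\phi_1(v),\dots,\phi_d(v))$. The predictor $\boldsymbol{f}$ is a classifier that provides a conditional distribution $\mathbb{P}_{\boldsymbol{f}}(\cdot\mid\boldsymbol{x})$ over outputs $Y$ given an input $\boldsymbol{x}$, and also a conditional distribution $\mathbb{P}_{\boldsymbol{f}}(\cdot\mid\boldsymbol{x}_s)$ over outputs given only the sub-vector $\boldsymbol{x}_s=\{x_i: i\in S\}$ of features indexed by $S\subseteq\{1,\dots,d\}$. For a point $\boldsymbol{z}\in\mathbb{R}^d$, the characteristic function associated with $\boldsymbol{f}$ and $\boldsymbol{z}$ is $$v_{\boldsymbol{z}}(S)=\mathbb{E}_Y\left[-\log\frac{1}{\mathbb{P}_{\boldsymbol{f}}(Y\mid\boldsymbol{z}_s)}\,\Big|\,\boldsymbol{z}\right],$$ where $\mathbb{E}_Y[\cdot\mid\boldsymbol{z}]$ is the expectation over $Y\sim\mathbb{P}_{\boldsymbol{f}}(\cdot\mid\boldsymbol{z})$;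 it is taken to be real-valued. A set of $k$ nearest neighbors is any minimizer $$\mathcal{N}_k(\boldsymbol{x}_{\text{test}})\in\arg\min_{\mathcal{N}\subset\mathcal{D}_{\boldsymbol{x}},\,|\mathcal{N}|=k}\ \sum_{\boldsymbol{z}\in\mathcal{N}}\rho(\boldsymbol{x}_{\text{test}},\boldsymbol{z}).$$ *)

theory Defs
  imports "HOL-Probability.Probability"
begin

text \<open>Players are the elements of a finite type \<open>'n\<close> with \<open>d = CARD('n)\<close>; a game is a
  function on coalitions \<open>S :: 'n set\<close>.\<close>

definition shapley_value :: "('n::finite set \<Rightarrow> real) \<Rightarrow> 'n \<Rightarrow> real" where
  "shapley_value v i =
     1 / real CARD('n) *
     (\<Sum>S \<in> Pow (UNIV - {i}).
        inverse (real ((CARD('n) - 1) choose card S)) * (v (S \<union> {i}) - v S))"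

text \<open>The sub-vector of \<open>x\<close> indexed by \<open>S\<close> is the partial map with domain \<open>S\<close>, so it carries
  \<open>S\<close> and the values of \<open>x\<close> on \<open>S\<close>, and nothing else.\<close>

definition subvector :: "real ^ 'n \<Rightarrow> 'n set \<Rightarrow> ('n \<rightharpoonup> real)" where
  "subvector x S = (\<lambda>i. if i \<in> S then Some (x $ i) else None)"

text \<open>A classifier with outputs in \<open>'y\<close>: \<open>full_dist f x\<close> is the output distribution given the whole
  input, \<open>sub_dist f xs\<close> the one given only a sub-vector. No relation between the two is
  imposed.\<close>

record ('n, 'y) predictor =
  full_dist :: "real ^ 'n \<Rightarrow> 'y pmf"
  sub_dist :: "('n \<rightharpoonup> real) \<Rightarrow> 'y pmf"

definition log_score :: "('n, 'y) predictor \<Rightarrow> real ^ 'n \<Rightarrow> 'n set \<Rightarrow> 'y \<Rightarrow> real" where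
  "log_score f z S y = - ln (1 / pmf (sub_dist f (subvector z S)) y)"

definition char_fun :: "('n, 'y) predictor \<Rightarrow> real ^ 'n \<Rightarrow> 'n set \<Rightarrow> real" where
  "char_fun f z S = measure_pmf.expectation (full_dist f z) (log_score f z S)"

text \<open>The expectation defining \<open>char_fun f z S\<close> is a genuine real number for every \<open>S\<close>: the
  logarithm is almost surely finite (otherwise the expectation is \<open>-\<infinity>\<close>, which the totalised
  \<open>ln\<close> and division would hide) and the integral exists.\<close>

definition char_fun_real_valued :: "('n, 'y) predictor \<Rightarrow> real ^ 'n \<Rightarrow> bool" where
  "char_fun_real_valued f z \<longleftrightarrow>
     (\<forall>S. (AE y in measure_pmf (full_dist f z). pmf (sub_dist f (subvector z S)) y > 0) \<and>
          integrable (measure_pmf (full_dist f z)) (log_score f z S))"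

definition nearest_neighbors ::
    "('a \<Rightarrow> 'a \<Rightarrow> real) \<Rightarrow> 'a set \<Rightarrow> nat \<Rightarrow> 'a \<Rightarrow> 'a set \<Rightarrow> bool" where
  "nearest_neighbors \<rho> D k x N \<longleftrightarrow>
     is_arg_min (\<lambda>N. \<Sum>z\<in>N. \<rho> x z) (\<lambda>N. N \<subseteq> D \<and> card N = k) N"

definition g_AVA ::
    "('n::finite, 'y) predictor \<Rightarrow> (real ^ 'n \<Rightarrow> real ^ 'n \<Rightarrow> real) \<Rightarrow> (real ^ 'n) set
      \<Rightarrow> real ^ 'n \<Rightarrow> real ^ 'n" where
  "g_AVA f \<rho> N x = (\<chi> i. \<Sum>z\<in>N. shapley_value (char_fun f z) i / \<rho> x z)"

definition v_AVA ::
    "('n::finite, 'y) predictor \<Rightarrow> (real ^ 'n \<Rightarrow> real ^ 'n \<Rightarrow> real) \<Rightarrow> (real ^ 'n) set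
      \<Rightarrow> real ^ 'n \<Rightarrow> 'n set \<Rightarrow> real" where
  "v_AVA f \<rho> N x S = (\<Sum>z\<in>N. char_fun f z S / \<rho> x z)"

end

theory Submission
  imports Defs
begin

text \<open>The Shapley value is linear in the game: it is a sum of marginal contributions with
  weights depending only on coalition sizes. \<open>v_AVA\<close> combines the games
  \<open>char_fun f z\<close> linearly with coefficients \<open>1 / \<rho> x_test z\<close>, so its
  Shapley values are the same combination of theirs, which is \<open>g_AVA\<close>.
  \<open>shapley_value_sum_scale\<close> carries this.\<close>

text \<open>Exchanging the sums over \<open>A\<close> and over coalitions suffices. \<open>A\<close>
  may be arbitrary: sums over an infinite set are 0 on both sides.\<close>

lemma shapley_value_sum_scale:
  "shapley_value (\<lambda>S. \<Sum>z\<in>A. c z * v z S) i = (\<Sum>z\<in>A. c z * shapley_value (v z) i)"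
proof -
  let ?w = "\<lambda>S. inverse (real ((CARD('a) - 1) choose card S))"
  have "(\<Sum>S\<in>Pow (UNIV - {i}).
          ?w S * ((\<Sum>z\<in>A. c z * v z (S \<union> {i})) - (\<Sum>z\<in>A. c z * v z S)))
      = (\<Sum>S\<in>Pow (UNIV - {i}). \<Sum>z\<in>A. c z * (?w S * (v z (S \<union> {i}) - v z S)))"
    by (simp only: sum_subtractf [symmetric] sum_distrib_left right_diff_distrib mult.left_commute)
  also have "\<dots> = (\<Sum>z\<in>A. c z * (\<Sum>S\<in>Pow (UNIV - {i}). ?w S * (v z (S \<union> {i}) - v z S)))"
    by (subst sum.swap) (simp only: sum_distrib_left)
  finally show ?thesis
    unfolding shapley_value_def by (simp only: sum_distrib_left mult.left_commute)
qed

theorem theorem5: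
  fixes f :: "('n::finite, 'y) predictor"
    and \<rho> :: "real ^ 'n \<Rightarrow> real ^ 'n \<Rightarrow> real"
    and D N :: "(real ^ 'n) set"
    and x_test :: "real ^ 'n"
    and k :: nat
  assumes "Metric_space UNIV \<rho>"
    and "finite D"
    and "nearest_neighbors \<rho> D k x_test N"
    and "\<And>z. z \<in> N \<Longrightarrow> \<rho> x_test z > 0"
    and "\<And>z. z \<in> N \<Longrightarrow> char_fun_real_valued f z"
  shows "\<forall>i. g_AVA f \<rho> N x_test $ i = shapley_value (v_AVA f \<rho> N x_test) i"
proof
  fix i
  \<comment> \<open>Division by the distance becomes a scalar factor, the shape in which linearity
    applies with \<open>c z = 1 / \<rho> x_test z\<close>.\<close>
  have "v_AVA f \<rho> N x_test = (\<lambda>S. \<Sum>z\<in>N. (1 / \<rho> x_test z) * char_fun f z S)"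
    by (simp add: v_AVA_def fun_eq_iff)
  then show "g_AVA f \<rho> N x_test $ i = shapley_value (v_AVA f \<rho> N x_test) i"
    by (simp only: shapley_value_sum_scale) (simp add: g_AVA_def)
qed

end
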